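(* Let $G(p)$ be a bar-and-joint framework in $\mathbb{S}^n_+$, with $G=(V,E)$ and $p:V\to\mathbb{S}^n_+$. A map $u:V\to\mathbb{R}^{n+1}$ is a first-order motion of the framework $G(p)$ in $\mathbb{S}^n_+$ if and only if $\varphi\circ u$ is a first-order motion of the framework $G(\psi\circ p)$ in $\mathbb{E}^n$. Moreover, a map $u:\mathbb{S}^n_+\to\mathbb{R}^{n+1}$ is a trivial first-order motion of $\mathbb{S}^n_+$ if and only if $\varphi\circ u\circ\psi^{-1}$ is a trivial first-order motion of $\mathbb{E}^n$.
   Context: Here $x\cdot y$ is the standard inner product on $\mathbb{R}^{n+1}$ and $\mathbf{e}=(0,\dots,0,1)\in\mathbb{R}^{n+1}$. Define $\mathbb{E}^n=\{x\in\mathbb{R}^{n+1}: \mathbf{e}\cdot x=1\}$ and $\mathbb{S}^n_+=\{x\in\mathbb{R}^{n+1}: x\cdot x=1,\ \mathbf{e}\cdot x>0\}$. The map $\psi:\mathbb{S}^n_+\to\mathbb{E}^n$ is $\psi(x)=x/(\mathbf{e}\cdot x)$, with inverse $\psi^{-1}(x)=x/\sqrt{x\cdot x}$. A graph $G=(V,E)$ consists of a finite vertex set $V$ and a collection $E$ of unordered pairs of vertices. A bar-and-joint framework $G(p)$ in $\mathbb{E}^n$ (resp. $\mathbb{S}^n_+$) is a graph $G$ together with a map $p:V\to\mathbb{E}^n$ (resp. $p:V\to\mathbb{S}^n_+$); write $p_i=p(i)$, $u_i=u(i)$. The map $\varphi$ carries vectors $u_i$ at points $p_i\in\mathbb{S}^n_+$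 to vectors at $\psi(p_i)\in\mathbb{E}^n$ by $\varphi: u_i\mapsto \frac{1}{\mathbf{e}\cdot p_i}\bigl(u_i-(u_i\cdot\mathbf{e})\,\mathbf{e}\bigr)$. For a framework $G(q)$ in $\mathbb{E}^n$ with first-order motion $v$, the inverse is given by $\varphi^{-1}: v_i\mapsto\frac{1}{\sqrt{q_i\cdot q_i}}\bigl(v_i-(v_i\cdot q_i)\,\mathbf{e}\bigr)$. For a map $u$ defined on all of $\mathbb{S}^n_+$, the same formula is used at every point: $(\varphi\circ u\circ\psi^{-1})(q)=\frac{1}{\mathbf{e}\cdot x}\bigl(u(x)-(u(x)\cdot\mathbf{e})\,\mathbf{e}\bigr)$ with $x=\psi^{-1}(q)$, for $q\in\mathbb{E}^n$. A first-order motion of $G(p)$ in $\mathbb{E}^n$ is a map $u:V\to\mathbb{R}^{n+1}$ with $(p_i-p_j)\cdot(u_i-u_j)=0$ for all $\{i,j\}\in E$ and $\mathbf{e}\cdot u_k=0$ for all $k\in V$. A trivial first-order motion of $\mathbb{E}^n$ is a map $u:\mathbb{E}^n\to\mathbb{R}^{n+1}$ with $(x-y)\cdot(u(x)-u(y))=0$ and $\mathbf{e}\cdot u(z)=0$ for all $x,y,z\in\mathbb{E}^n$. A first-order motion of $G(p)$ in $\mathbb{S}^n_+$ is a map $u:V\to\mathbb{R}^{n+1}$ with $p_i\cdot u_j+p_j\cdot u_i=0$ for all $\{i,j\}\in E$ and $p_k\cdot u_k=0$ for all $k\in V$. A trivial first-order motion of $\mathbb{S}^n_+$ is a map $u:\mathbb{S}^n_+\to\mathbb{R}^{n+1}$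 with $x\cdot u(y)+y\cdot u(x)=0$ and $z\cdot u(z)=0$ for all $x,y,z\in\mathbb{S}^n_+$.
   Formalization: Both equivalences are stated for tangent u only (p_k·u_k=0 for all k in V; x·u(x)=0 on the hemisphere); for arbitrary u the "if" directions fail, e.g. one vertex with p=u=e gives φ(u)=0 but p·u=1. *)

theory Defs
  imports "HOL-Analysis.Analysis"
begin

text \<open>
  The ambient space \<open>\<real>\<^sup>n\<^sup>+\<^sup>1\<close> is \<^typ>\<open>real ^ 'm\<close> for a finite linearly ordered index type with
  \<open>CARD('m) = n + 1\<close>, so every \<open>n \<ge> 0\<close> is covered; \<open>\<e>\<close> below is the unit vector of the
  last index.
\<close>

definition e_last :: "real ^ 'm::{finite,linorder}"  ("\<e>")
  where "\<e> = axis (Max UNIV) 1"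

definition euclid :: "(real ^ 'm::{finite,linorder}) set"
  where "euclid = {x. \<e> \<bullet> x = 1}"

definition hemisphere :: "(real ^ 'm::{finite,linorder}) set"
  where "hemisphere = {x. x \<bullet> x = 1 \<and> \<e> \<bullet> x > 0}"

definition psi :: "real ^ 'm::{finite,linorder} \<Rightarrow> real ^ 'm::{finite,linorder}"  ("\<psi>")
  where "\<psi> x = (1 / (\<e> \<bullet> x)) *\<^sub>R x"

definition psi_inv :: "real ^ 'm::{finite,linorder} \<Rightarrow> real ^ 'm::{finite,linorder}"
  where "psi_inv x = (1 / sqrt (x \<bullet> x)) *\<^sub>R x"

text \<open>
  \<open>\<phi> x w\<close> is the image of a vector \<open>w\<close> at the point \<open>x\<close> of the hemisphere; it is a vector at
  \<open>\<psi> x\<close>. Its value does not depend on the component of \<open>w\<close> along \<open>\<e>\<close>, so it is injective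
  only on vectors tangent to the sphere at \<open>x\<close>, that is, those with \<open>x \<bullet> w = 0\<close>.
\<close>

definition phi ::
    "real ^ 'm::{finite,linorder} \<Rightarrow> real ^ 'm::{finite,linorder} \<Rightarrow> real ^ 'm::{finite,linorder}"  ("\<phi>")
  where "\<phi> x w = (1 / (\<e> \<bullet> x)) *\<^sub>R (w - (w \<bullet> \<e>) *\<^sub>R \<e>)"

definition graph :: "'v set \<Rightarrow> 'v set set \<Rightarrow> bool"
  where "graph V E \<longleftrightarrow> finite V \<and> (\<forall>d\<in>E. \<exists>i\<in>V. \<exists>j\<in>V. i \<noteq> j \<and> d = {i, j})"

definition framework ::
    "(real ^ 'm::{finite,linorder}) set \<Rightarrow> 'v set \<Rightarrow> 'v set set \<Rightarrow>
      ('v \<Rightarrow> real ^ 'm::{finite,linorder}) \<Rightarrow> bool"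
  where "framework X V E p \<longleftrightarrow> graph V E \<and> p \<in> V \<rightarrow> X"

definition euclid_motion ::
    "'v set \<Rightarrow> 'v set set \<Rightarrow> ('v \<Rightarrow> real ^ 'm::{finite,linorder}) \<Rightarrow>
      ('v \<Rightarrow> real ^ 'm::{finite,linorder}) \<Rightarrow> bool"
  where "euclid_motion V E p u \<longleftrightarrow>
    framework euclid V E p \<and>
    (\<forall>i j. {i, j} \<in> E \<longrightarrow> (p i - p j) \<bullet> (u i - u j) = 0) \<and>
    (\<forall>k\<in>V. \<e> \<bullet> u k = 0)"

definition euclid_trivial ::
    "(real ^ 'm::{finite,linorder} \<Rightarrow> real ^ 'm::{finite,linorder}) \<Rightarrow> bool"
  where "euclid_trivial u \<longleftrightarrow>
    (\<forall>x\<in>euclid. \<forall>y\<in>euclid. (x - y) \<bullet> (u x - u y) = 0) \<and>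
    (\<forall>z\<in>euclid. \<e> \<bullet> u z = 0)"

definition sphere_motion ::
    "'v set \<Rightarrow> 'v set set \<Rightarrow> ('v \<Rightarrow> real ^ 'm::{finite,linorder}) \<Rightarrow>
      ('v \<Rightarrow> real ^ 'm::{finite,linorder}) \<Rightarrow> bool"
  where "sphere_motion V E p u \<longleftrightarrow>
    framework hemisphere V E p \<and>
    (\<forall>i j. {i, j} \<in> E \<longrightarrow> p i \<bullet> u j + p j \<bullet> u i = 0) \<and>
    (\<forall>k\<in>V. p k \<bullet> u k = 0)"

definition sphere_trivial ::
    "(real ^ 'm::{finite,linorder} \<Rightarrow> real ^ 'm::{finite,linorder}) \<Rightarrow> bool"
  where "sphere_trivial u \<longleftrightarrow>
    (\<forall>x\<in>hemisphere. \<forall>y\<in>hemisphere. x \<bullet> u y + y \<bullet> u x = 0) \<and>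
    (\<forall>z\<in>hemisphere. z \<bullet> u z = 0)"

end

theory Submission imports Defs begin

text \<open>
  Everything follows from one identity. Write \<open>a = \<e> \<bullet> x\<close> and \<open>b = \<e> \<bullet> y\<close>. The points \<open>\<psi> x = x / a\<close> and
  \<open>\<psi> y = y / b\<close> have the same height over \<open>\<e>\<^sup>\<bottom>\<close>, so their difference is orthogonal to \<open>\<e>\<close>, and in a
  product with it the projection of \<open>w / a\<close> to \<open>\<e>\<^sup>\<bottom>\<close> made by \<open>\<phi>\<close> is invisible:
  \<open>(\<psi> x - \<psi> y) \<bullet> (\<phi> x w - \<phi> y z) = (x / a - y / b) \<bullet> (w / a - z / b)\<close>. For tangent vectors, where
  \<open>x \<bullet> w = y \<bullet> z = 0\<close>, only the mixed terms of this product remain, and they add up to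
  \<open>- (x \<bullet> z + y \<bullet> w) / (a b)\<close> (lemma \<open>psi_diff_inner_phi_diff\<close>).
  Hence for each pair of points the Euclidean first-order condition is a nonzero multiple of the spherical
  one. Applied to the edges this gives the statement about frameworks; applied to all
  pairs of points, which \<open>\<psi>\<close> and \<open>psi_inv\<close> put into bijection, it gives the statement about
  trivial motions.
\<close>

lemma e_last_inner_self: "\<e> \<bullet> \<e> = 1"
  by (simp add: e_last_def inner_axis_axis)

lemma e_last_inner_phi: "\<e> \<bullet> \<phi> x w = 0"
  by (simp add: phi_def inner_diff_right e_last_inner_self inner_commute)

lemma psi_in_euclid: "x \<in> hemisphere \<Longrightarrow> \<psi> x \<in> euclid"
  by (simp add: hemisphere_def euclid_def psi_def)

lemma e_last_inner_pos: "x \<in> hemisphere \<Longrightarrow> 0 < \<e> \<bullet> x"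
  by (simp add: hemisphere_def)

lemma euclid_inner_self_pos:
  assumes "q \<in> euclid"
  shows "0 < q \<bullet> q"
proof -
  have "q \<noteq> 0" using assms by (auto simp: euclid_def)
  then show ?thesis by simp
qed

lemma psi_inv_in_hemisphere: "q \<in> euclid \<Longrightarrow> psi_inv q \<in> hemisphere"
  using euclid_inner_self_pos[of q]
  by (simp add: hemisphere_def psi_inv_def euclid_def field_simps)

lemma psi_psi_inv: "q \<in> euclid \<Longrightarrow> \<psi> (psi_inv q) = q"
  using euclid_inner_self_pos[of q]
  by (simp add: psi_def psi_inv_def euclid_def)

lemma psi_inv_psi: "x \<in> hemisphere \<Longrightarrow> psi_inv (\<psi> x) = x"
  by (simp add: psi_def psi_inv_def hemisphere_def real_sqrt_mult real_sqrt_divide)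

text \<open>
  Tangency of \<open>w\<close> and \<open>z\<close> removes the diagonal terms \<open>x \<bullet> w\<close> and \<open>y \<bullet> z\<close> of the product; the
  mixed terms are the spherical first-order expression.
\<close>

lemma psi_diff_inner_phi_diff:
  assumes a: "\<e> \<bullet> x \<noteq> 0" and b: "\<e> \<bullet> y \<noteq> 0" and w: "x \<bullet> w = 0" and z: "y \<bullet> z = 0"
  shows "(\<psi> x - \<psi> y) \<bullet> (\<phi> x w - \<phi> y z) = - (x \<bullet> z + y \<bullet> w) / ((\<e> \<bullet> x) * (\<e> \<bullet> y))"
proof -
  define a b where "a = \<e> \<bullet> x" and "b = \<e> \<bullet> y"
  define d where "d = \<psi> x - \<psi> y"
  have "\<e> \<bullet> d = 0"
    using a b by (simp add: d_def psi_def inner_diff_right)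
  then have d_e: "d \<bullet> \<e> = 0"
    by (simp add: inner_commute)
  have "d \<bullet> (\<phi> x w - \<phi> y z) = d \<bullet> ((1 / a) *\<^sub>R w - (1 / b) *\<^sub>R z)"
    by (simp add: phi_def a_def b_def inner_diff_right d_e)
  also have "\<dots> = - (x \<bullet> z + y \<bullet> w) / (a * b)"
    using a b w z
    by (simp add: d_def psi_def inner_diff_left inner_diff_right
        flip: a_def b_def) (simp add: field_simps)
  finally show ?thesis by (simp add: d_def a_def b_def)
qed

lemma first_order_condition_iff:
  assumes x: "x \<in> hemisphere" and y: "y \<in> hemisphere" and w: "x \<bullet> w = 0" and z: "y \<bullet> z = 0"
  shows "(\<psi> x - \<psi> y) \<bullet> (\<phi> x w - \<phi> y z) = 0 \<longleftrightarrow> x \<bullet> z + y \<bullet> w = 0"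
proof -
  have a: "\<e> \<bullet> x \<noteq> 0" and b: "\<e> \<bullet> y \<noteq> 0"
    using x y by (auto dest: e_last_inner_pos)
  show ?thesis
    unfolding psi_diff_inner_phi_diff[OF a b w z] using a b by auto
qed

lemma sphere_motion_iff_euclid_motion:
  assumes F: "framework hemisphere V E p" and tangent: "\<forall>k\<in>V. p k \<bullet> u k = 0"
  shows "sphere_motion V E p u \<longleftrightarrow> euclid_motion V E (\<psi> \<circ> p) (\<lambda>i. \<phi> (p i) (u i))"
proof -
  have p: "p k \<in> hemisphere" if "k \<in> V" for k
    using F that by (auto simp: framework_def)
  have FE: "framework euclid V E (\<psi> \<circ> p)"
    using F psi_in_euclid[OF p] by (simp add: framework_def)
  have V: "i \<in> V \<and> j \<in> V" if "{i, j} \<in> E" for i j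
    using F that by (fastforce simp: framework_def graph_def doubleton_eq_iff)
  have "(\<psi> (p i) - \<psi> (p j)) \<bullet> (\<phi> (p i) (u i) - \<phi> (p j) (u j)) = 0
      \<longleftrightarrow> p i \<bullet> u j + p j \<bullet> u i = 0" if "{i, j} \<in> E" for i j
    using V[OF that] p tangent by (intro first_order_condition_iff) auto
  then show ?thesis
    using F FE tangent by (simp add: sphere_motion_def euclid_motion_def e_last_inner_phi)
qed

lemma sphere_trivial_iff_euclid_trivial:
  assumes tangent: "\<forall>x\<in>hemisphere. x \<bullet> u x = 0"
  shows "sphere_trivial u \<longleftrightarrow> euclid_trivial (\<lambda>q. \<phi> (psi_inv q) (u (psi_inv q)))"
    (is "_ \<longleftrightarrow> euclid_trivial ?v")
proof -
  have euclid_eq: "euclid = \<psi> ` hemisphere"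
  proof
    show "euclid \<subseteq> \<psi> ` hemisphere"
      using psi_psi_inv psi_inv_in_hemisphere by (metis image_eqI subsetI)
  qed (auto intro: psi_in_euclid)
  \<comment> \<open>Index the pairs in \<open>euclid\<close> by the hemisphere, where the pointwise equivalence applies.\<close>
  have "euclid_trivial ?v \<longleftrightarrow>
      (\<forall>x\<in>hemisphere. \<forall>y\<in>hemisphere. (\<psi> x - \<psi> y) \<bullet> (\<phi> x (u x) - \<phi> y (u y)) = 0)"
    by (simp add: euclid_trivial_def euclid_eq e_last_inner_phi psi_inv_psi)
  also have "\<dots> \<longleftrightarrow> (\<forall>x\<in>hemisphere. \<forall>y\<in>hemisphere. x \<bullet> u y + y \<bullet> u x = 0)"
    using tangent by (simp add: first_order_condition_iff)
  finally show ?thesis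
    using tangent by (simp add: sphere_trivial_def)
qed

theorem theorem4p2:
  fixes V :: "'v set" and E :: "'v set set"
    and p :: "'v \<Rightarrow> real ^ 'm::{finite,linorder}"
  assumes "framework hemisphere V E p"
  shows "(\<forall>u :: 'v \<Rightarrow> real ^ 'm::{finite,linorder}.
            (\<forall>k\<in>V. p k \<bullet> u k = 0) \<longrightarrow>
            (sphere_motion V E p u \<longleftrightarrow>
             euclid_motion V E (\<psi> \<circ> p) (\<lambda>i. \<phi> (p i) (u i)))) \<and>
         (\<forall>u :: real ^ 'm::{finite,linorder} \<Rightarrow> real ^ 'm::{finite,linorder}.
            (\<forall>x\<in>hemisphere. x \<bullet> u x = 0) \<longrightarrow>
            (sphere_trivial u \<longleftrightarrow>
             euclid_trivial (\<lambda>q. \<phi> (psi_inv q) (u (psi_inv q)))))"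
  using sphere_motion_iff_euclid_motion[OF assms] sphere_trivial_iff_euclid_trivial by blast

end
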